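(* In every homogeneous-goods market $(S,B,\mathbf v,G)$ and for every transaction fee $\alpha\in[0,1]$, the greedy Algorithm described in the context outputs a set $P\subseteq S$ of sellers that is a pure Platform Equilibrium at fee $\alpha$.
   Context: A homogeneous-goods market $(S,B,\mathbf v,G)$ consists of a finite set $B$ of $n$ buyers, a finite set $S$ of $m$ sellers (each owning one item), a value $v_i\ge 0$ for each buyer $i$ (the buyer's value for any single item, each buyer wanting at most one item), and a bipartite graph $G$ between $B$ and $S$ whose edges are the pairs that can transact directly. $W(S',B',G)$ denotes the maximum total value of matched buyers over matchings between $B'\subseteq B$ and $S'\subseteq S$ that use only edges of $G$. For a set $P\subseteq S$ of sellers joining the platform, $G(P)$ is obtained from $G$ by adding all edges between $P$ and $B$. The market clears at the maximum competitive (Walrasian) equilibrium prices with respect to $G(P)$, which equal $p_j(P)=W(S,B,G(P))-W(S\setminus\{j\},B,G(P))$. A set $P\subseteq S$ is a pure Platform Equilibrium at fee $\alpha$ if for all $j\in P$: $(1-\alpha)p_j(P)\ge p_j(P\setminus\{j\})$, and for all $j\notin P$: $p_j(P)\ge(1-\alpha)p_j(P\cup\{j\})$. For $j\in S$ and $P\subseteq S$ put $p_j^{\mathrm{on}}(P)=p_j(P\cup\{j\})$, $p_j^{\mathrm{off}}(P)=p_j(P\setminus\{j\})$ and $\phi_j^P=(1-\alpha)p_j^{\mathrm{on}}(P)-p_j^{\mathrm{off}}(P)$. Algorithm (for fixed $\alpha$): Start with $P=\emptyset$. While $P\ne S$: let $\Phi_{\max}^P=\arg\max_{j\in S\setminus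 P}\phi_j^P$ and choose $\hat j\in\arg\min_{j\in\Phi_{\max}^P}p_j^{\mathrm{off}}(P)$; if $\phi_{\hat j}^P\ge 0$, replace $P$ by $P\cup\{\hat j\}$ and continue (recomputing all quantities); otherwise stop. Output $P$. *)

theory Defs
  imports Complex_Main
begin

section \<open>Matchings and maximum welfare\<close>

text \<open>An edge is a pair (buyer, seller).\<close>

definition matchings :: "'s set \<Rightarrow> 'b set \<Rightarrow> ('b \<times> 's) set \<Rightarrow> ('b \<times> 's) set set" where
  "matchings S' B' E = {M. M \<subseteq> E \<inter> B' \<times> S' \<and> inj_on fst M \<and> inj_on snd M}"

text \<open>For finite \<open>S'\<close> and \<open>B'\<close> the set of matchings is finite, and it contains the empty
  matching, so the maximum is attained.\<close>

definition welfare :: "('b \<Rightarrow> real) \<Rightarrow> 's set \<Rightarrow> 'b set \<Rightarrow> ('b \<times> 's) set \<Rightarrow> real" where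
  "welfare v S' B' E = Max ((\<lambda>M. \<Sum>i\<in>fst ` M. v i) ` matchings S' B' E)"

section \<open>Homogeneous-goods markets\<close>

locale homogeneous_market =
  fixes S :: "'s set" and B :: "'b set" and v :: "'b \<Rightarrow> real" and G :: "('b \<times> 's) set"
  assumes finite_S: "finite S"
    and finite_B: "finite B"
    and v_nonneg: "\<And>i. i \<in> B \<Longrightarrow> 0 \<le> v i"
    and G_edges: "G \<subseteq> B \<times> S"
begin

definition platform_graph :: "'s set \<Rightarrow> ('b \<times> 's) set" where
  "platform_graph P = G \<union> B \<times> P"

text \<open>The maximum competitive equilibrium price of seller \<open>j\<close> when the sellers in \<open>P\<close> have
  joined the platform, given by the marginal contribution of \<open>j\<close> to the maximum welfare.\<close>

definition price :: "'s \<Rightarrow> 's set \<Rightarrow> real" where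
  "price j P = welfare v S B (platform_graph P) - welfare v (S - {j}) B (platform_graph P)"

definition platform_equilibrium :: "real \<Rightarrow> 's set \<Rightarrow> bool" where
  "platform_equilibrium \<alpha> P \<longleftrightarrow> P \<subseteq> S \<and>
     (\<forall>j\<in>P. (1 - \<alpha>) * price j P \<ge> price j (P - {j})) \<and>
     (\<forall>j\<in>S - P. price j P \<ge> (1 - \<alpha>) * price j (P \<union> {j}))"

section \<open>The greedy algorithm\<close>

definition price_on :: "'s \<Rightarrow> 's set \<Rightarrow> real" where
  "price_on j P = price j (P \<union> {j})"

definition price_off :: "'s \<Rightarrow> 's set \<Rightarrow> real" where
  "price_off j P = price j (P - {j})"

definition join_gain :: "real \<Rightarrow> 's set \<Rightarrow> 's \<Rightarrow> real" where
  "join_gain \<alpha> P j = (1 - \<alpha>) * price_on j P - price_off j P"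

definition max_gain_sellers :: "real \<Rightarrow> 's set \<Rightarrow> 's set" where
  "max_gain_sellers \<alpha> P = {j. is_arg_max (join_gain \<alpha> P) (\<lambda>j. j \<in> S - P) j}"

definition candidates :: "real \<Rightarrow> 's set \<Rightarrow> 's set" where
  "candidates \<alpha> P =
     {j. is_arg_min (\<lambda>j. price_off j P) (\<lambda>j. j \<in> max_gain_sellers \<alpha> P) j}"

text \<open>The choice among the candidates is arbitrary, so one round of the loop is a relation
  between the current set and the next one.\<close>

definition greedy_step :: "real \<Rightarrow> 's set \<Rightarrow> 's set \<Rightarrow> bool" where
  "greedy_step \<alpha> P Q \<longleftrightarrow>
     P \<noteq> S \<and> (\<exists>j\<in>candidates \<alpha> P. join_gain \<alpha> P j \<ge> 0 \<and> Q = P \<union> {j})"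

definition greedy_stops :: "real \<Rightarrow> 's set \<Rightarrow> bool" where
  "greedy_stops \<alpha> P \<longleftrightarrow> P = S \<or> (\<exists>j\<in>candidates \<alpha> P. join_gain \<alpha> P j < 0)"

definition greedy_output :: "real \<Rightarrow> 's set \<Rightarrow> bool" where
  "greedy_output \<alpha> P \<longleftrightarrow> (greedy_step \<alpha>)\<^sup>*\<^sup>* {} P \<and> greedy_stops \<alpha> P"

definition greedy_terminates :: "real \<Rightarrow> bool" where
  "greedy_terminates \<alpha> \<longleftrightarrow>
     \<not> (\<exists>f :: nat \<Rightarrow> 's set. f 0 = {} \<and> (\<forall>k. greedy_step \<alpha> (f k) (f (Suc k))))"

end

end

theory Submission
  imports Defs
begin

text \<open>
  Call a set of buyers matchable into a set of sellers if some matching covers it. Rerouting along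
  an alternating path gives an exchange property for matchable sets, which makes the maximum value
  of a set matchable into \<open>T\<close> an M-natural-concave (gross substitutes) function of \<open>T\<close>.

  Let \<open>W T k\<close> be this maximum when the sellers are \<open>T\<close>, with their original links, and \<open>k\<close> further
  sellers linked to every buyer. For a platform \<open>P\<close> of size \<open>k\<close> and \<open>T = S - P\<close>, the gain of
  \<open>j \<in> T\<close> from joining is \<open>(1 - \<alpha>) W (T - j) (k + 1) + \<alpha> W (T - j) k - W T k\<close>. Since goods are
  homogeneous, \<open>W (T - i) k \<ge> W (T - j) k\<close> implies \<open>W (T - i) (k + 1) \<ge> W (T - j) (k + 1)\<close>, so the
  algorithm always moves a seller \<open>j\<close> with \<open>W (T - j) k\<close> maximal. Hence \<open>W T k\<close> can never be
  increased by replacing a member of \<open>T\<close> by a member of \<open>P\<close>. Applied just before the last seller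
  joins, this shows that a platform seller gains at least as much from being on the platform as
  that last seller, whose gain was nonnegative.
\<close>

section \<open>Matchable sets of buyers\<close>

definition matchable :: "('b \<times> 't) set \<Rightarrow> 't set \<Rightarrow> 'b set \<Rightarrow> bool" where
  "matchable E T X \<longleftrightarrow> (\<exists>g. inj_on g X \<and> (\<forall>b\<in>X. g b \<in> T \<and> (b, g b) \<in> E))"

lemma matchable_empty: "matchable E T {}"
  by (simp add: matchable_def)

lemma matchable_mono: "matchable E T X \<Longrightarrow> T \<subseteq> T' \<Longrightarrow> matchable E T' X"
  unfolding matchable_def by blast

lemma matchable_subset_Domain: "matchable E T X \<Longrightarrow> X \<subseteq> Domain E"
  unfolding matchable_def by blast

lemma matchable_insert:
  assumes "matchable E T X" "s \<notin> T" "b \<notin> X" "(b, s) \<in> E"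
  shows "matchable E (insert s T) (insert b X)"
proof -
  obtain g where g: "inj_on g X" "\<forall>b\<in>X. g b \<in> T \<and> (b, g b) \<in> E"
    using assms(1) unfolding matchable_def by blast
  have "inj_on (g(b := s)) (insert b X)"
    using g assms(2,3) by (auto simp: inj_on_def)
  moreover have "\<forall>c\<in>insert b X. (g(b := s)) c \<in> insert s T \<and> (c, (g(b := s)) c) \<in> E"
    using g assms(4) by auto
  ultimately show ?thesis
    unfolding matchable_def by blast
qed

lemma matchable_remove_buyer:
  assumes "matchable E T X" "b \<in> X"
  obtains t where "t \<in> T" "(b, t) \<in> E" "matchable E (T - {t}) (X - {b})"
proof -
  obtain g where g: "inj_on g X" "\<forall>b\<in>X. g b \<in> T \<and> (b, g b) \<in> E"
    using assms(1) unfolding matchable_def by blast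
  have "inj_on g (X - {b})" "\<forall>c\<in>X - {b}. g c \<in> T - {g b} \<and> (c, g c) \<in> E"
    using g assms(2) by (auto simp: inj_on_def)
  then have "matchable E (T - {g b}) (X - {b})"
    unfolding matchable_def by blast
  then show thesis
    using that g(2) assms(2) by blast
qed

lemma matchable_remove_seller:
  assumes "matchable E T X"
  obtains "matchable E (T - {s}) X"
  | b where "b \<in> X" "(b, s) \<in> E" "matchable E (T - {s}) (X - {b})"
proof -
  obtain g where g: "inj_on g X" "\<forall>b\<in>X. g b \<in> T \<and> (b, g b) \<in> E"
    using assms unfolding matchable_def by blast
  show thesis
  proof (cases "s \<in> g ` X")
    case False
    then have "matchable E (T - {s}) X"
      using g unfolding matchable_def by blast
    then show thesis by (rule that(1))
  next
    case True
    then obtain b where b: "b \<in> X" "g b = s" by blast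
    have "inj_on g (X - {b})" "\<forall>c\<in>X - {b}. g c \<in> T - {s} \<and> (c, g c) \<in> E"
      using g b by (auto simp: inj_on_def)
    then have "matchable E (T - {s}) (X - {b})"
      unfolding matchable_def by blast
    then show thesis using that(2) b g(2) by blast
  qed
qed

lemma matchable_image:
  assumes "matchable E T X" "inj_on h T"
    and "\<And>b t. t \<in> T \<Longrightarrow> (b, t) \<in> E \<Longrightarrow> (b, h t) \<in> E'"
  shows "matchable E' (h ` T) X"
proof -
  obtain g where g: "inj_on g X" "\<forall>b\<in>X. g b \<in> T \<and> (b, g b) \<in> E"
    using assms(1) unfolding matchable_def by blast
  have "inj_on (h \<circ> g) X"
    using g assms(2) by (intro comp_inj_on) (auto intro: inj_on_subset)
  moreover have "\<forall>b\<in>X. (h \<circ> g) b \<in> h ` T \<and> (b, (h \<circ> g) b) \<in> E'"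
    using g assms(3) by auto
  ultimately show ?thesis
    unfolding matchable_def by blast
qed

text \<open>The recursion follows the alternating path that starts at \<open>s\<close> with an edge of the matching
  of \<open>Y\<close>. The three outcomes are: \<open>s\<close> can be dispensed with; the path ends at a buyer; the path
  ends at a seller \<open>t\<close>.\<close>

lemma matchable_exchange:
  assumes "finite U" "matchable E T X" "matchable E U Y" "s \<in> U - T"
  shows "matchable E (U - {s}) Y \<or>
    (\<exists>b\<in>Y - X. matchable E (insert s T) (insert b X) \<and> matchable E (U - {s}) (Y - {b})) \<or>
    (\<exists>t\<in>T - U. matchable E (insert s (T - {t})) X \<and> matchable E (insert t (U - {s})) Y)"
  using assms
proof (induction U arbitrary: T X Y s rule: finite_psubset_induct)
  case (psubset U)
  show ?case
  proof (rule matchable_remove_seller[OF psubset.prems(2), of s])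
    assume "matchable E (U - {s}) Y"
    then show ?thesis by blast
  next
    fix b assume b: "b \<in> Y" "(b, s) \<in> E" "matchable E (U - {s}) (Y - {b})"
    show ?thesis
    proof (cases "b \<in> X")
      case False
      then have "matchable E (insert s T) (insert b X)"
        using b(2) psubset.prems by (intro matchable_insert) auto
      then show ?thesis
        using b(1,3) False by blast
    next
      case True
      obtain t where t: "t \<in> T" "(b, t) \<in> E" "matchable E (T - {t}) (X - {b})"
        using matchable_remove_buyer[OF psubset.prems(1) True] .
      have s: "s \<in> U" "s \<notin> T" "s \<noteq> t"
        using psubset.prems(3) t(1) by auto
      have X: "insert b (X - {b}) = X" and Y: "insert b (Y - {b}) = Y"
        using True b(1) by auto
      show ?thesis
      proof (cases "t \<in> U")
        case False
        have "matchable E (insert s (T - {t})) X"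
          using matchable_insert[OF t(3), of s b] s b(2) X by simp
        moreover have "matchable E (insert t (U - {s})) Y"
          using matchable_insert[OF b(3), of t b] False t(2) Y by simp
        ultimately show ?thesis using False t(1) by blast
      next
        case tU: True
        have Ut: "insert t (U - {s} - {t}) = U - {s}" and Tt: "insert t (T - {t}) = T"
          using tU s t(1) by auto
        \<comment> \<open>Dropping \<open>b\<close> from both sets, together with \<open>s\<close>
          and \<open>t\<close>, leaves the same situation with \<open>t\<close> as the start of the
          path. Each outcome is lifted by putting \<open>b\<close> back, matched to \<open>t\<close>
          on the side of \<open>Y\<close> and, where needed, to \<open>s\<close> on the side of
          \<open>X\<close>.\<close>
        have "U - {s} \<subset> U" "t \<in> (U - {s}) - (T - {t})"
          using tU s by auto
        from psubset.IH[OF this(1) t(3) b(3) this(2)]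
        consider "matchable E (U - {s} - {t}) (Y - {b})"
          | b' where "b' \<in> (Y - {b}) - (X - {b})"
              "matchable E (insert t (T - {t})) (insert b' (X - {b}))"
              "matchable E (U - {s} - {t}) (Y - {b} - {b'})"
          | t' where "t' \<in> (T - {t}) - (U - {s})"
              "matchable E (insert t (T - {t} - {t'})) (X - {b})"
              "matchable E (insert t' (U - {s} - {t})) (Y - {b})"
          by (elim disjE bexE conjE)
        then show ?thesis
        proof cases
          case 1
          then have "matchable E (U - {s}) Y"
            using matchable_insert[OF 1, of t b] t(2) Y Ut by simp
          then show ?thesis by blast
        next
          case (2 b')
          have "matchable E (insert s T) (insert b (insert b' (X - {b})))"
            using 2 s b(2) unfolding Tt by (intro matchable_insert) auto
          moreover have "insert b (insert b' (X - {b})) = insert b' X"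
            using True by auto
          moreover have "matchable E (insert t (U - {s} - {t})) (insert b (Y - {b} - {b'}))"
            using 2 t(2) by (intro matchable_insert) auto
          moreover have "insert b (Y - {b} - {b'}) = Y - {b'}"
            using 2 b(1) by auto
          ultimately show ?thesis
            unfolding Ut using 2(1) by auto
        next
          case (3 t')
          have "insert t (T - {t} - {t'}) = T - {t'}"
            using 3(1) t(1) by auto
          then have "matchable E (insert s (T - {t'})) X"
            using matchable_insert[OF 3(2), of s b] s b(2) X by auto
          moreover have "insert t (insert t' (U - {s} - {t})) = insert t' (U - {s})"
            using Ut by auto
          then have "matchable E (insert t' (U - {s})) Y"
            using matchable_insert[OF 3(3), of t b] 3(1) t(2) Y by auto
          moreover have "t' \<in> T - U"
            using 3(1) s by auto
          ultimately show ?thesis by blast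
        qed
      qed
    qed
  qed
qed

section \<open>The maximum value of a matchable set\<close>

text \<open>Finiteness is asked of the buyer side alone, because the graph used below has the
  infinite supply \<open>range Inr\<close> of sellers.\<close>

locale weighted_graph =
  fixes E :: "('b \<times> 't) set" and v :: "'b \<Rightarrow> real"
  assumes finite_Domain: "finite (Domain E)"
begin

definition max_value :: "'t set \<Rightarrow> real" where
  "max_value T = Max (sum v ` {X. matchable E T X})"

lemma finite_matchable: "finite {X. matchable E T X}"
  by (rule finite_subset[of _ "Pow (Domain E)"])
    (auto simp: finite_Domain dest: matchable_subset_Domain)

lemma matchable_finite: "matchable E T X \<Longrightarrow> finite X"
  by (rule finite_subset[OF matchable_subset_Domain finite_Domain])

lemma sum_le_max_value: "matchable E T X \<Longrightarrow> sum v X \<le> max_value T"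
  unfolding max_value_def using finite_matchable by (intro Max_ge) auto

lemma max_value_attained:
  obtains X where "matchable E T X" "sum v X = max_value T"
proof -
  have "max_value T \<in> sum v ` {X. matchable E T X}"
    unfolding max_value_def using finite_matchable matchable_empty by (intro Max_in) auto
  then show thesis using that by auto
qed

lemma max_value_mono: "T \<subseteq> T' \<Longrightarrow> max_value T \<le> max_value T'"
  by (rule max_value_attained[of T]) (metis matchable_mono sum_le_max_value)

text \<open>Local form of M-natural-concavity. Apply \<open>matchable_exchange\<close> to optimal
  sets with \<open>s = z\<close>: every outcome preserves the total value of the two sets, and
  \<open>x\<close> is the only seller that can be traded back for \<open>z\<close>. Dispensing with
  \<open>z\<close> or passing on a buyer gives the first inequality, trading \<open>x\<close> for
  \<open>z\<close> the second.\<close>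

lemma max_value_exchange:
  assumes "finite R" "x \<notin> R" "y \<notin> R" "z \<notin> R" "x \<noteq> y" "x \<noteq> z" "y \<noteq> z"
  shows "max_value (insert x R) + max_value (insert y (insert z R)) \<le>
      max_value (insert y R) + max_value (insert x (insert z R)) \<or>
    max_value (insert x R) + max_value (insert y (insert z R)) \<le>
      max_value (insert z R) + max_value (insert x (insert y R))"
proof -
  let ?T = "insert x R" and ?U = "insert y (insert z R)"
  obtain X where X: "matchable E ?T X" "sum v X = max_value ?T"
    using max_value_attained .
  obtain Y where Y: "matchable E ?U Y" "sum v Y = max_value ?U"
    using max_value_attained .
  have eqs: "?U - {z} = insert y R" "insert z ?T = insert x (insert z R)"
    "?T - ?U = {x}" "insert z (?T - {x}) = insert z R"
    "insert x (?U - {z}) = insert x (insert y R)"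
    using assms by auto
  have "finite ?U" "z \<in> ?U - ?T"
    using assms by auto
  from matchable_exchange[OF this(1) X(1) Y(1) this(2)]
  consider "matchable E (?U - {z}) Y"
    | b where "b \<in> Y - X" "matchable E (insert z ?T) (insert b X)"
        "matchable E (?U - {z}) (Y - {b})"
    | t where "t \<in> ?T - ?U" "matchable E (insert z (?T - {t})) X"
        "matchable E (insert t (?U - {z})) Y"
    by (elim disjE bexE conjE)
  then show ?thesis
  proof cases
    case 1
    have "sum v Y \<le> max_value (insert y R)"
      using sum_le_max_value[OF 1] unfolding eqs .
    moreover have "max_value ?T \<le> max_value (insert x (insert z R))"
      by (intro max_value_mono) auto
    ultimately show ?thesis using Y by linarith
  next
    case (2 b)
    have "sum v (insert b X) \<le> max_value (insert x (insert z R))"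
      "sum v (Y - {b}) \<le> max_value (insert y R)"
      using 2(2,3) unfolding eqs by (auto intro: sum_le_max_value)
    moreover have "sum v (insert b X) = v b + sum v X" "sum v (Y - {b}) = sum v Y - v b"
      using 2(1) matchable_finite X(1) Y(1) by (auto simp: sum_diff1)
    ultimately show ?thesis using X Y by linarith
  next
    case (3 t)
    then have "t = x" using eqs(3) by blast
    have "sum v X \<le> max_value (insert z R)"
      "sum v Y \<le> max_value (insert x (insert y R))"
      using 3(2,3) unfolding \<open>t = x\<close> eqs by (auto intro: sum_le_max_value)
    then show ?thesis using X Y by linarith
  qed
qed

text \<open>Compare \<open>A\<close> with an optimum for \<open>insert x R\<close>. A path ending at
  a seller would need one in \<open>R\<close> but not in \<open>insert x R\<close>, so either the
  new optimum already fits into \<open>R\<close>, or a single buyer passes from it to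
  \<open>A\<close>.\<close>

lemma optimal_extension:
  assumes "finite R" "x \<notin> R" "matchable E R A" "sum v A = max_value R"
  obtains A' where "matchable E (insert x R) A'" "sum v A' = max_value (insert x R)"
    "A' = A \<or> (\<exists>b. b \<notin> A \<and> A' = insert b A)"
proof -
  let ?U = "insert x R"
  obtain Y where Y: "matchable E ?U Y" "sum v Y = max_value ?U"
    using max_value_attained .
  have A: "matchable E ?U A"
    using assms(3) by (rule matchable_mono) auto
  have U: "?U - {x} = R" "R - ?U = {}" "finite ?U" "x \<in> ?U - R"
    using assms by auto
  from matchable_exchange[OF U(3) assms(3) Y(1) U(4)] U
  consider "matchable E R Y"
    | b where "b \<in> Y - A" "matchable E ?U (insert b A)" "matchable E R (Y - {b})"
    by auto
  then show thesis
  proof cases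
    case 1
    then have "sum v A = max_value ?U"
      using sum_le_max_value[OF 1] sum_le_max_value[OF A] assms(4) Y(2) by linarith
    then show thesis using that A by blast
  next
    case (2 b)
    have "sum v (insert b A) = v b + sum v A" "sum v (Y - {b}) = sum v Y - v b"
      using 2(1) matchable_finite A Y(1) by (auto simp: sum_diff1)
    then have "sum v (insert b A) = max_value ?U"
      using sum_le_max_value[OF 2(2)] sum_le_max_value[OF 2(3)] assms(4) Y(2) by linarith
    then show thesis using that 2 by blast
  qed
qed

text \<open>This is where homogeneity enters: a buyer has the same value at every seller. From a
  common optimum \<open>A\<close> for \<open>R\<close>, the optima \<open>X\<close> and
  \<open>Y\<close> arise by adding at most one buyer each, and \<open>C\<close> by adding at most
  one more to \<open>X\<close>. Some buyer of \<open>C\<close> can then be served by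
  \<open>u\<close> on top of \<open>Y\<close>, unless \<open>Y\<close> alone is already good
  enough.\<close>

lemma max_value_insert_universal:
  assumes "finite R" "x \<notin> R" "y \<notin> R" "u \<notin> R" "u \<noteq> x" "u \<noteq> y"
    and universal: "\<And>b. b \<in> Domain E \<Longrightarrow> (b, u) \<in> E"
    and le: "max_value (insert x R) \<le> max_value (insert y R)"
  shows "max_value (insert u (insert x R)) \<le> max_value (insert u (insert y R))"
proof -
  obtain A where A: "matchable E R A" "sum v A = max_value R"
    using max_value_attained .
  obtain X where X: "matchable E (insert x R) X" "sum v X = max_value (insert x R)"
    "X = A \<or> (\<exists>b. b \<notin> A \<and> X = insert b A)"
    using optimal_extension[OF assms(1,2) A] .
  obtain Y where Y: "matchable E (insert y R) Y" "sum v Y = max_value (insert y R)"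
    "Y = A \<or> (\<exists>b. b \<notin> A \<and> Y = insert b A)"
    using optimal_extension[OF assms(1,3) A] .
  have u: "u \<notin> insert x R" "u \<notin> insert y R" "finite (insert x R)"
    using assms by auto
  obtain C where C: "matchable E (insert u (insert x R)) C"
    "sum v C = max_value (insert u (insert x R))"
    "C = X \<or> (\<exists>t. t \<notin> X \<and> C = insert t X)"
    using optimal_extension[OF u(3,1) X(1,2)] .
  have mono: "max_value (insert y R) \<le> max_value (insert u (insert y R))"
    by (intro max_value_mono) auto
  have add: "sum v Y + v b \<le> max_value (insert u (insert y R))" if "b \<in> C" "b \<notin> Y" for b
  proof -
    have "matchable E (insert u (insert y R)) (insert b Y)"
      using that matchable_subset_Domain[OF C(1)] Y(1) u
      by (intro matchable_insert universal) auto
    then show ?thesis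
      using sum_le_max_value that(2) matchable_finite[OF Y(1)] by fastforce
  qed
  show ?thesis
  proof (cases "C = X")
    case True
    then show ?thesis using mono le C(2) X(2) by simp
  next
    case False
    then obtain t where t: "t \<notin> X" "C = insert t X" using C(3) by blast
    then have sumC: "sum v C = v t + sum v X"
      using matchable_finite[OF X(1)] by simp
    show ?thesis
    proof (cases "t \<in> Y")
      case False
      then show ?thesis using add[of t] t sumC C(2) X(2) Y(2) le by simp
    next
      \<comment> \<open>Now \<open>t\<close> is the buyer that \<open>y\<close> brings to
        \<open>A\<close>. If \<open>x\<close> brings nobody, then \<open>C\<close> equals
        \<open>Y\<close>; if it brings \<open>b\<close>, then \<open>C\<close> is \<open>Y\<close>
        together with \<open>b\<close>.\<close>
      case True
      then have YA: "Y = insert t A" "t \<notin> A"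
        using Y(3) X(3) t(1) by auto
      then have sumY: "sum v Y = v t + sum v A"
        using matchable_finite[OF A(1)] by simp
      show ?thesis
      proof (cases "X = A")
        case True
        then show ?thesis using sumC sumY C(2) Y(2) mono by simp
      next
        case False
        then obtain b where b: "b \<notin> A" "X = insert b A" using X(3) by blast
        then have "sum v X = v b + sum v A" "b \<in> C" "b \<notin> Y"
          using matchable_finite[OF A(1)] t YA by auto
        then show ?thesis using add[of b] sumC sumY C(2) by simp
      qed
    qed
  qed
qed

end

text \<open>The value of a matching depends only on the buyers it covers, and the sets that can be
  covered are exactly the matchable ones. The hypothesis ensures that restricting edges to
  \<open>B\<close> loses none.\<close>

lemma welfare_eq_max_matchable:
  assumes "E \<subseteq> B \<times> UNIV"
  shows "welfare v T B E = Max (sum v ` {X. matchable E T X})"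
proof -
  have "(`) fst ` matchings T B E = {X. matchable E T X}"
  proof (intro equalityI subsetI)
    fix X assume "X \<in> (`) fst ` matchings T B E"
    then obtain M where M: "M \<subseteq> E \<inter> B \<times> T" "inj_on fst M" "inj_on snd M" "X = fst ` M"
      unfolding matchings_def by blast
    \<comment> \<open>The assignment sends each covered buyer to the seller on its unique edge in
      \<open>M\<close>.\<close>
    have "inj_on (snd \<circ> the_inv_into M fst) X"
      unfolding M(4)
      using M by (intro comp_inj_on inj_on_the_inv_into) (simp_all add: the_inv_into_onto)
    moreover have "(snd \<circ> the_inv_into M fst) b \<in> T \<and> (b, (snd \<circ> the_inv_into M fst) b) \<in> E"
      if b: "b \<in> X" for b
    proof -
      obtain p where "p \<in> M" "b = fst p" using b M(4) by blast
      moreover from this have "the_inv_into M fst b = p"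
        using M(2) by (simp add: the_inv_into_f_f)
      ultimately show ?thesis using M(1) by (cases p) auto
    qed
    ultimately show "X \<in> {X. matchable E T X}"
      unfolding matchable_def by blast
  next
    fix X assume "X \<in> {X. matchable E T X}"
    then obtain g where g: "inj_on g X" "\<forall>b\<in>X. g b \<in> T \<and> (b, g b) \<in> E"
      unfolding matchable_def by blast
    have "(\<lambda>b. (b, g b)) ` X \<in> matchings T B E"
      using g assms unfolding matchings_def by (auto simp: inj_on_def)
    moreover have "X = fst ` (\<lambda>b. (b, g b)) ` X"
      by (simp add: image_image)
    ultimately show "X \<in> (`) fst ` matchings T B E" by blast
  qed
  then show ?thesis
    unfolding welfare_def by (simp flip: image_image[of "sum v" "(`) fst"])
qed

section \<open>The greedy algorithm\<close>

context homogeneous_market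
begin

text \<open>Sellers on the platform are interchangeable, so only their number matters. They are
  modelled by copies \<open>Inr n\<close> linked to every buyer, while \<open>Inl s\<close> keeps
  the original links of \<open>s\<close>; one fixed graph thus serves all platforms.\<close>

definition ext_graph :: "('b \<times> ('s + nat)) set" where
  "ext_graph = {(b, Inl s) | b s. (b, s) \<in> G} \<union> B \<times> range Inr"

lemma Domain_ext_graph: "Domain ext_graph = B"
  using G_edges unfolding ext_graph_def by auto

sublocale ext: weighted_graph ext_graph v
  by unfold_locales (simp add: Domain_ext_graph finite_B)

definition ext_sellers :: "'s set \<Rightarrow> nat \<Rightarrow> ('s + nat) set" where
  "ext_sellers T k = Inl ` T \<union> Inr ` {..<k}"

definition W :: "'s set \<Rightarrow> nat \<Rightarrow> real" where
  "W T k = ext.max_value (ext_sellers T k)"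

lemma ext_sellers_insert: "ext_sellers (insert s T) k = insert (Inl s) (ext_sellers T k)"
  and ext_sellers_Suc: "ext_sellers T (Suc k) = insert (Inr k) (ext_sellers T k)"
  and finite_ext_sellers: "finite T \<Longrightarrow> finite (ext_sellers T k)"
  and Inl_in_ext_sellers: "Inl s \<in> ext_sellers T k \<longleftrightarrow> s \<in> T"
  and Inr_in_ext_sellers: "Inr n \<in> ext_sellers T k \<longleftrightarrow> n < k"
  by (auto simp: ext_sellers_def)

lemma W_exchange:
  assumes "finite R" "x \<notin> R" "y \<notin> R" "z \<notin> R" "x \<noteq> y" "x \<noteq> z" "y \<noteq> z"
  shows "W (insert x R) k + W (insert y (insert z R)) k \<le>
      W (insert y R) k + W (insert x (insert z R)) k \<or>
    W (insert x R) k + W (insert y (insert z R)) k \<le>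
      W (insert z R) k + W (insert x (insert y R)) k"
  using assms unfolding W_def ext_sellers_insert
  by (intro ext.max_value_exchange) (auto simp: finite_ext_sellers Inl_in_ext_sellers)

lemma W_Suc_mono:
  assumes "finite R" "x \<notin> R" "y \<notin> R" "W (insert x R) k \<le> W (insert y R) k"
  shows "W (insert x R) (Suc k) \<le> W (insert y R) (Suc k)"
proof -
  have "(b, Inr k) \<in> ext_graph" if "b \<in> Domain ext_graph" for b
    using that unfolding Domain_ext_graph by (simp add: ext_graph_def)
  moreover have "ext_sellers (insert s R) (Suc k) = insert (Inr k) (insert (Inl s) (ext_sellers R k))"
    for s by (simp add: ext_sellers_insert ext_sellers_Suc)
  ultimately show ?thesis
    using assms ext.max_value_insert_universal[of "ext_sellers R k" "Inl x" "Inl y" "Inr k"]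
    by (simp add: W_def ext_sellers_insert finite_ext_sellers Inl_in_ext_sellers
        Inr_in_ext_sellers)
qed

text \<open>Renaming the sellers in \<open>K\<close> to \<open>Inr 0\<close>, \<open>Inr 1\<close>,
  ... and each \<open>s\<close> in \<open>T\<close> to \<open>Inl s\<close> preserves edges in both
  directions, as \<open>T\<close> avoids \<open>P\<close>. Allowing \<open>K\<close> to be smaller
  than \<open>P\<close> covers the deletion of a platform seller from the market while the graph
  stays fixed.\<close>

lemma welfare_platform_graph:
  assumes "P \<subseteq> S" "K \<subseteq> P" "T \<inter> P = {}"
  shows "welfare v (T \<union> K) B (platform_graph P) = W T (card K)"
proof -
  have K: "finite K" using finite_subset[OF assms(1) finite_S] assms(2) by (rule rev_finite_subset)
  obtain e where e: "bij_betw e K {..<card K}"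
    using ex_bij_betw_finite_nat[OF K] by (auto simp: atLeast0LessThan)
  define h where "h s = (if s \<in> K then Inr (e s) else Inl s)" for s
  have disj: "T \<inter> K = {}" using assms by blast
  have h: "inj_on h (T \<union> K)"
    using e disj by (auto simp: h_def inj_on_def bij_betw_def)
  have "h ` T = Inl ` T" "h ` K = Inr ` e ` K"
    using disj by (force simp: h_def)+
  then have img: "h ` (T \<union> K) = ext_sellers T (card K)"
    using e by (auto simp: ext_sellers_def bij_betw_def image_Un)
  have edges: "(b, s) \<in> platform_graph P \<longleftrightarrow> (b, h s) \<in> ext_graph" if "s \<in> T \<union> K" for b s
    using that assms G_edges by (auto simp: platform_graph_def ext_graph_def h_def)
  have "matchable (platform_graph P) (T \<union> K) X \<longleftrightarrow> matchable ext_graph (ext_sellers T (card K)) X"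
    for X
  proof
    assume "matchable (platform_graph P) (T \<union> K) X"
    from matchable_image[OF this h, of ext_graph]
    show "matchable ext_graph (ext_sellers T (card K)) X"
      using edges unfolding img by blast
  next
    let ?h' = "the_inv_into (T \<union> K) h"
    assume "matchable ext_graph (ext_sellers T (card K)) X"
    then have "matchable ext_graph (h ` (T \<union> K)) X" unfolding img .
    then have "matchable (platform_graph P) (?h' ` h ` (T \<union> K)) X"
    proof (rule matchable_image[OF _ inj_on_the_inv_into[OF h]])
      fix b t assume "t \<in> h ` (T \<union> K)" "(b, t) \<in> ext_graph"
      then show "(b, ?h' t) \<in> platform_graph P"
        using edges by (auto simp: the_inv_into_f_f[OF h])
    qed
    then show "matchable (platform_graph P) (T \<union> K) X"
      by (simp add: the_inv_into_onto[OF h])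
  qed
  moreover have "platform_graph P \<subseteq> B \<times> UNIV"
    using G_edges by (auto simp: platform_graph_def)
  ultimately show ?thesis
    by (simp add: welfare_eq_max_matchable W_def ext.max_value_def)
qed

section \<open>Prices and gains in terms of \<open>W\<close>\<close>

lemma price_not_member:
  assumes "P \<subseteq> S" "j \<in> S - P"
  shows "price j P = W (S - P) (card P) - W (S - P - {j}) (card P)"
proof -
  have "S = (S - P) \<union> P" "S - {j} = (S - P - {j}) \<union> P"
    using assms by auto
  then have "welfare v S B (platform_graph P) = W (S - P) (card P)"
    "welfare v (S - {j}) B (platform_graph P) = W (S - P - {j}) (card P)"
    using welfare_platform_graph[of P P "S - P"] welfare_platform_graph[of P P "S - P - {j}"]
      assms by auto
  then show ?thesis by (simp add: price_def)
qed

lemma price_insert: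
  assumes "P \<subseteq> S" "j \<in> S - P"
  shows "price j (insert j P) = W (S - P - {j}) (Suc (card P)) - W (S - P - {j}) (card P)"
proof -
  have "S = (S - P - {j}) \<union> insert j P" "S - {j} = (S - P - {j}) \<union> P"
    using assms by auto
  moreover have "card (insert j P) = Suc (card P)"
    using assms finite_subset[OF _ finite_S] by simp
  \<comment> \<open>Deleting \<open>j\<close> keeps the graph of \<open>insert j P\<close> but
    leaves only the \<open>card P\<close> universal sellers in \<open>P\<close>.\<close>
  ultimately have "welfare v S B (platform_graph (insert j P)) = W (S - P - {j}) (Suc (card P))"
    "welfare v (S - {j}) B (platform_graph (insert j P)) = W (S - P - {j}) (card P)"
    using welfare_platform_graph[of "insert j P" "insert j P" "S - P - {j}"]
      welfare_platform_graph[of "insert j P" P "S - P - {j}"] assms by auto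
  then show ?thesis by (simp add: price_def)
qed

lemma price_off_eq:
  assumes "P \<subseteq> S" "j \<in> S - P"
  shows "price_off j P = W (S - P) (card P) - W (S - P - {j}) (card P)"
  using price_not_member[OF assms] assms by (simp add: price_off_def)

lemma join_gain_eq:
  assumes "P \<subseteq> S" "j \<in> S - P"
  shows "join_gain \<alpha> P j = (1 - \<alpha>) * W (S - P - {j}) (Suc (card P))
    + \<alpha> * W (S - P - {j}) (card P) - W (S - P) (card P)"
  by (simp add: join_gain_def price_on_def price_insert[OF assms] price_off_eq[OF assms]
      algebra_simps)

text \<open>If \<open>i\<close> were strictly better than \<open>j\<close> at \<open>card P\<close>,
  then by \<open>W_Suc_mono\<close> it would be at least as good at \<open>Suc (card P)\<close>. The
  gain weights these two values by \<open>\<alpha>\<close> and \<open>1 - \<alpha>\<close>, so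
  \<open>i\<close> would also have maximal gain, but with a strictly lower off-platform price,
  against the tie-breaking rule.\<close>

lemma candidate_max_remaining:
  assumes "0 \<le> \<alpha>" "\<alpha> \<le> 1" "P \<subseteq> S" "j \<in> candidates \<alpha> P" "i \<in> S - P"
  shows "W (S - P - {i}) (card P) \<le> W (S - P - {j}) (card P)"
proof (rule ccontr)
  let ?T = "S - P" and ?k = "card P"
  assume "\<not> ?thesis"
  then have less: "W (?T - {j}) ?k < W (?T - {i}) ?k" by simp
  have j: "j \<in> ?T" and jmax: "\<And>l. l \<in> ?T \<Longrightarrow> join_gain \<alpha> P l \<le> join_gain \<alpha> P j"
    and jmin: "\<And>l. l \<in> max_gain_sellers \<alpha> P \<Longrightarrow> price_off j P \<le> price_off l P"
    using assms(4) by (auto simp: candidates_def max_gain_sellers_def is_arg_min_linorder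
        is_arg_max_linorder)
  have ij: "i \<noteq> j" using less by auto
  have "insert i (?T - {i} - {j}) = ?T - {j}" "insert j (?T - {i} - {j}) = ?T - {i}"
    using ij j assms(5) by auto
  then have "W (?T - {j}) (Suc ?k) \<le> W (?T - {i}) (Suc ?k)"
    using W_Suc_mono[of "?T - {i} - {j}" i j ?k] less finite_S by simp
  then have "join_gain \<alpha> P j \<le> join_gain \<alpha> P i"
    using less assms(1,2)
    unfolding join_gain_eq[OF assms(3) j] join_gain_eq[OF assms(3,5)]
    by (intro diff_right_mono add_mono mult_left_mono) auto
  then have "i \<in> max_gain_sellers \<alpha> P"
    using jmax assms(5) by (force simp: max_gain_sellers_def is_arg_max_linorder)
  then show False
    using jmin less price_off_eq[OF assms(3) j] price_off_eq[OF assms(3,5)] by force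
qed

lemma candidates_nonempty:
  assumes "P \<subseteq> S" "P \<noteq> S"
  shows "candidates \<alpha> P \<noteq> {}"
proof -
  have fin: "finite (S - P)" "S - P \<noteq> {}" using finite_S assms by auto
  then have "max_gain_sellers \<alpha> P \<noteq> {}"
    \<comment> \<open>A maximizer of the gain is obtained as a minimizer of its negative.\<close>
    using ex_is_arg_min_if_finite[OF fin, of "\<lambda>j. - join_gain \<alpha> P j"]
    by (auto simp: max_gain_sellers_def is_arg_max_def is_arg_min_def)
  moreover have "max_gain_sellers \<alpha> P \<subseteq> S - P"
    by (auto simp: max_gain_sellers_def is_arg_max_def)
  then have "finite (max_gain_sellers \<alpha> P)" using fin(1) by (rule finite_subset)
  ultimately show ?thesis
    using ex_is_arg_min_if_finite[of "max_gain_sellers \<alpha> P" "\<lambda>j. price_off j P"]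
    by (auto simp: candidates_def)
qed

text \<open>The loop invariant, with \<open>T = S - P\<close> and \<open>k = card P\<close>: local
  optimality of the off-platform set under exchanges that keep its size.\<close>

definition swap_optimal :: "'s set \<Rightarrow> nat \<Rightarrow> bool" where
  "swap_optimal T k \<longleftrightarrow> (\<forall>i\<in>T. \<forall>j\<in>S - T. W (insert j (T - {i})) k \<le> W T k)"

lemma swap_optimal_Suc:
  assumes "swap_optimal T k" "finite T"
  shows "swap_optimal T (Suc k)"
  unfolding swap_optimal_def
proof (intro ballI)
  fix i j assume ij: "i \<in> T" "j \<in> S - T"
  then have T: "insert i (T - {i}) = T" by auto
  have "W (insert j (T - {i})) k \<le> W (insert i (T - {i})) k"
    using assms(1) ij unfolding swap_optimal_def T by blast
  then show "W (insert j (T - {i})) (Suc k) \<le> W T (Suc k)"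
    using W_Suc_mono[of "T - {i}" j i k] ij assms(2) unfolding T by simp
qed

text \<open>For \<open>j\<close> outside \<open>T\<close>, apply \<open>W_exchange\<close> to
  \<open>T - {z} - {i}\<close> and the sellers \<open>j\<close>, \<open>i\<close>, \<open>z\<close>.
  Swap optimality bounds the set containing \<open>j\<close> on the right by \<open>W T k\<close>,
  which cancels. What remains is a bound by \<open>W (T - {z}) k\<close> or by
  \<open>W (T - {i}) k\<close>, and the latter is no larger by the choice of
  \<open>z\<close>.\<close>

lemma swap_optimal_remove:
  assumes "swap_optimal T k" "finite T" "z \<in> T"
    and max: "\<And>i. i \<in> T \<Longrightarrow> W (T - {i}) k \<le> W (T - {z}) k"
  shows "swap_optimal (T - {z}) k"
  unfolding swap_optimal_def
proof (intro ballI)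
  fix i j assume i: "i \<in> T - {z}" and j: "j \<in> S - (T - {z})"
  let ?R = "T - {z} - {i}"
  have T: "insert i ?R = T - {z}" "insert z ?R = T - {i}" "insert i (insert z ?R) = T"
    using i assms(3) by auto
  show "W (insert j ?R) k \<le> W (T - {z}) k"
  proof (cases "j = z")
    \<comment> \<open>Swapping in the seller just removed turns \<open>T - {z}\<close> into
      \<open>T - {i}\<close>, so the choice of \<open>z\<close> suffices.\<close>
    case True
    then show ?thesis using max i T by auto
  next
    case False
    then have jT: "j \<in> S - T" using j by blast
    have "insert j (insert z ?R) = insert j (T - {i})" "insert j (insert i ?R) = insert j (T - {z})"
      using T by auto
    then have "W (insert j (insert z ?R)) k \<le> W T k" "W (insert j (insert i ?R)) k \<le> W T k"
      using assms(1,3) i jT unfolding swap_optimal_def by auto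
    moreover have "W (insert j ?R) k + W T k \<le> W (T - {z}) k + W (insert j (insert z ?R)) k \<or>
        W (insert j ?R) k + W T k \<le> W (T - {i}) k + W (insert j (insert i ?R)) k"
      using W_exchange[of ?R j i z k] i jT assms(2,3)
      unfolding T(3) unfolding T(1,2) by blast
    ultimately show ?thesis using max[of i] i by auto
  qed
qed

lemma greedy_step_invariant:
  assumes "0 \<le> \<alpha>" "\<alpha> \<le> 1" "P \<subseteq> S" "swap_optimal (S - P) (card P)" "greedy_step \<alpha> P Q"
  shows "Q \<subseteq> S" "card Q = Suc (card P)" "swap_optimal (S - Q) (card Q)"
    "\<forall>j\<in>Q. price j (Q - {j}) \<le> (1 - \<alpha>) * price j Q"
proof -
  let ?T = "S - P" and ?k = "card P"
  obtain z where z: "z \<in> candidates \<alpha> P" "join_gain \<alpha> P z \<ge> 0" and Q: "Q = insert z P"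
    using assms(5) by (auto simp: greedy_step_def)
  have zT: "z \<in> ?T"
    using z(1) by (auto simp: candidates_def max_gain_sellers_def is_arg_min_def is_arg_max_def)
  have finP: "finite P" using assms(3) finite_S by (rule finite_subset)
  show QS: "Q \<subseteq> S" using Q zT assms(3) by auto
  show cardQ: "card Q = Suc ?k" using Q zT finP by simp
  have SQ: "S - Q = ?T - {z}" using Q by auto
  \<comment> \<open>The invariant is restored in two moves: first \<open>z\<close> leaves the
    off-platform set at the old count, then the count goes up by one.\<close>
  have "swap_optimal (S - Q) ?k"
    unfolding SQ using candidate_max_remaining[OF assms(1-3) z(1)] finite_S zT
    by (intro swap_optimal_remove assms(4)) auto
  then show "swap_optimal (S - Q) (card Q)"
    unfolding cardQ using finite_S by (intro swap_optimal_Suc) auto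
  show "\<forall>j\<in>Q. price j (Q - {j}) \<le> (1 - \<alpha>) * price j Q"
  proof
    fix j assume j: "j \<in> Q"
    have sub: "Q - {j} \<subseteq> S" "j \<in> S - (Q - {j})" "insert j (Q - {j}) = Q"
      "S - (Q - {j}) = insert j (S - Q)" "insert j (S - Q) - {j} = S - Q"
      using j QS by auto
    have card: "card (Q - {j}) = ?k"
      using j cardQ by simp
    \<comment> \<open>If \<open>j\<close> left \<open>Q\<close>, the off-platform set would be
      \<open>S - P\<close> with \<open>z\<close> exchanged for \<open>j\<close>, so the invariant
      before the step applies. The gain of \<open>j\<close> relative to \<open>Q - {j}\<close>
      depends on \<open>j\<close> only through this term, hence is at least the gain of
      \<open>z\<close>.\<close>
    have "W (insert j (S - Q)) ?k \<le> W ?T ?k"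
    proof (cases "j = z")
      case True
      then have "insert j (S - Q) = ?T" using SQ zT by auto
      then show ?thesis by simp
    next
      case False
      then have "j \<in> S - ?T" using j Q assms(3) by auto
      then show ?thesis
        using assms(4) zT unfolding swap_optimal_def SQ by blast
    qed
    also have "\<dots> \<le> (1 - \<alpha>) * W (S - Q) (Suc ?k) + \<alpha> * W (S - Q) ?k"
      using z(2) unfolding join_gain_eq[OF assms(3) zT] SQ by simp
    finally have "W (insert j (S - Q)) ?k - W (S - Q) ?k
        \<le> (1 - \<alpha>) * (W (S - Q) (Suc ?k) - W (S - Q) ?k)"
      by (simp add: algebra_simps)
    then show "price j (Q - {j}) \<le> (1 - \<alpha>) * price j Q"
      using price_not_member[OF sub(1,2)] price_insert[OF sub(1,2)]
      unfolding sub(3) unfolding sub(4) sub(5) card by simp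
  qed
qed

lemma greedy_reachable_invariant:
  assumes "0 \<le> \<alpha>" "\<alpha> \<le> 1" "(greedy_step \<alpha>)\<^sup>*\<^sup>* {} P"
  shows "P \<subseteq> S \<and> swap_optimal (S - P) (card P) \<and>
    (\<forall>j\<in>P. price j (P - {j}) \<le> (1 - \<alpha>) * price j P)"
  using assms(3)
proof (induction rule: rtranclp_induct)
  \<comment> \<open>Initially all of \<open>S\<close> is off the platform, so there is nothing to
    swap in.\<close>
  case base
  show ?case by (simp add: swap_optimal_def)
next
  case (step P Q)
  then show ?case using greedy_step_invariant[OF assms(1,2), of P Q] by blast
qed

section \<open>Equilibrium, termination and existence of an output\<close>

lemma greedy_output_equilibrium:
  assumes "0 \<le> \<alpha>" "\<alpha> \<le> 1" "greedy_output \<alpha> P"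
  shows "platform_equilibrium \<alpha> P"
proof -
  have inv: "P \<subseteq> S" "\<forall>j\<in>P. price j (P - {j}) \<le> (1 - \<alpha>) * price j P"
    and stops: "greedy_stops \<alpha> P"
    using greedy_reachable_invariant[OF assms(1,2)] assms(3) by (auto simp: greedy_output_def)
  \<comment> \<open>A candidate attains the maximal gain, so a negative gain there bounds the gains
    of all outsiders.\<close>
  have "join_gain \<alpha> P j \<le> 0" if j: "j \<in> S - P" for j
  proof -
    obtain i where "i \<in> candidates \<alpha> P" "join_gain \<alpha> P i < 0"
      using stops j by (auto simp: greedy_stops_def)
    moreover from this j have "join_gain \<alpha> P j \<le> join_gain \<alpha> P i"
      by (auto simp: candidates_def max_gain_sellers_def is_arg_min_linorder is_arg_max_linorder)
    ultimately show ?thesis by simp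
  qed
  then show ?thesis
    using inv by (auto simp: platform_equilibrium_def join_gain_def price_on_def price_off_def)
qed

lemma greedy_terminates:
  assumes "0 \<le> \<alpha>" "\<alpha> \<le> 1"
  shows "greedy_terminates \<alpha>"
  unfolding greedy_terminates_def
proof
  assume "\<exists>f :: nat \<Rightarrow> 's set. f 0 = {} \<and> (\<forall>k. greedy_step \<alpha> (f k) (f (Suc k)))"
  then obtain f :: "nat \<Rightarrow> 's set"
    where f: "f 0 = {}" "\<And>k. greedy_step \<alpha> (f k) (f (Suc k))" by blast
  have "(greedy_step \<alpha>)\<^sup>*\<^sup>* {} (f k)" for k
    using f by (induction k) (auto intro: rtranclp.rtrancl_into_rtrancl)
  then have inv: "f k \<subseteq> S" "swap_optimal (S - f k) (card (f k))" for k
    using greedy_reachable_invariant[OF assms] by blast+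
  have "card (f (Suc k)) = Suc (card (f k))" for k
    by (rule greedy_step_invariant(2)[OF assms inv f(2)])
  then have "card (f k) = k" for k
    using f(1) by (induction k) auto
  \<comment> \<open>After \<open>Suc (card S)\<close> rounds the platform would have more sellers
    than \<open>S\<close>.\<close>
  then show False
    using card_mono[OF finite_S inv(1)[of "Suc (card S)"]] by simp
qed

lemma greedy_output_exists:
  assumes "0 \<le> \<alpha>" "\<alpha> \<le> 1"
  shows "\<exists>P. greedy_output \<alpha> P"
proof -
  \<comment> \<open>Generalized to every reachable \<open>P\<close>, for induction on the number of
    sellers off the platform; reachability supplies the invariant.\<close>
  have "\<exists>Q. (greedy_step \<alpha>)\<^sup>*\<^sup>* P Q \<and> greedy_stops \<alpha> Q" if "(greedy_step \<alpha>)\<^sup>*\<^sup>* {} P" for P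
    using that
  proof (induction "card S - card P" arbitrary: P rule: less_induct)
    case less
    have inv: "P \<subseteq> S" "swap_optimal (S - P) (card P)"
      using greedy_reachable_invariant[OF assms less.prems] by auto
    show ?case
    proof (cases "greedy_stops \<alpha> P")
      case True
      then show ?thesis by blast
    next
      case False
      then have "P \<noteq> S" and gain: "\<forall>j\<in>candidates \<alpha> P. join_gain \<alpha> P j \<ge> 0"
        by (auto simp: greedy_stops_def not_less)
      then obtain Q where Q: "greedy_step \<alpha> P Q"
        using candidates_nonempty[OF inv(1), of \<alpha>] by (auto simp: greedy_step_def)
      have "card Q = Suc (card P)" "card Q \<le> card S"
        using greedy_step_invariant(1,2)[OF assms inv Q] card_mono[OF finite_S] by blast+
      then have "card S - card Q < card S - card P" by linarith
      moreover have "(greedy_step \<alpha>)\<^sup>*\<^sup>* {} Q" using less.prems Q by simp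
      ultimately obtain Q' where "(greedy_step \<alpha>)\<^sup>*\<^sup>* Q Q'" "greedy_stops \<alpha> Q'"
        using less.hyps by blast
      then show ?thesis using Q by (meson converse_rtranclp_into_rtranclp)
    qed
  qed
  then show ?thesis unfolding greedy_output_def by blast
qed

end

theorem theorem3p5:
  fixes S :: "'s set" and B :: "'b set" and v :: "'b \<Rightarrow> real" and G :: "('b \<times> 's) set"
    and \<alpha> :: real
  assumes "homogeneous_market S B v G"
    and "0 \<le> \<alpha>" and "\<alpha> \<le> 1"
  shows "homogeneous_market.greedy_terminates S B v G \<alpha> \<and>
    (\<exists>P. homogeneous_market.greedy_output S B v G \<alpha> P) \<and>
    (\<forall>P. homogeneous_market.greedy_output S B v G \<alpha> P \<longrightarrow>
      P \<subseteq> S \<and> homogeneous_market.platform_equilibrium S B v G \<alpha> P)"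
proof -
  interpret homogeneous_market S B v G by (rule assms(1))
  show ?thesis
    using greedy_terminates greedy_output_exists greedy_output_equilibrium assms(2,3)
    by (simp add: platform_equilibrium_def)
qed

end
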